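(* Let $X_0, X_1, X_2, \ldots$ be a Markov process with state space $S$, where $X_0$ is a constant. Let $f$ be a non-negative real-valued function on $S$ such that, for all $t$, $\Pr[f(X_t) - f(X_{t+1}) \ge 0 \mid X_t] = 1$. Let $U$ and $\epsilon$ be constants such that for every state $x$ with $f(x) > 0$ and every $t$, $\Pr[f(X_t) - f(X_{t+1}) \ge U \mid X_t = x] \le \epsilon$. Let $\tau = \min\{ t : f(X_t) = 0\}$. For each $x \in S$ with $f(x) > 0$, let $\mu_x > 0$ satisfy $\mu_x \ge \mathbb{E}[f(X_t) - f(X_{t+1}) \mid X_t = x,\ f(X_t) - f(X_{t+1}) < U]$. Define $m_z = \sup\{\mu_x : x \in S,\ f(x) \in [z, z+U)\}$ and $T(x) = \int_0^{f(x)} \frac{1}{m_z}\, dz$. Then $$\mathbb{E}[\tau] \ge \frac{T(X_0)}{\epsilon\, T(X_0) + (1-\epsilon)}.$$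
   Formalization: The formal theorem assumes ε ≤ 1; for ε > 1 the claim can fail (one state with f=1 jumping to 0 at once, U=2, μ=5/3, ε=2: bound 3 but E[τ]=1). When T(X_0) is infinite the ratio is read as its limit 1/ε. *)

theory Defs
  imports "HOL-Probability.Probability"
begin

definition natural_filtration ::
  "'a measure \<Rightarrow> 'b measure \<Rightarrow> (nat \<Rightarrow> 'a \<Rightarrow> 'b) \<Rightarrow> nat \<Rightarrow> 'a measure" where
  "natural_filtration P M X t =
     sigma (space P) {X s -` A \<inter> space P | s A. s \<le> t \<and> A \<in> sets M}"

text \<open>
  A discrete-time, not necessarily time-homogeneous, Markov process on the measurable state
  space \<open>M\<close>. The probability measure \<open>K t x\<close> is the law of \<open>X (Suc t)\<close> conditioned on \<open>X t = x\<close>;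
  on a general state space this is the meaning given to conditioning on the (possibly null)
  event \<open>X t = x\<close>. The last assumption is the Markov property: given the whole past up
  to time \<open>t\<close>, the law of \<open>X (Suc t)\<close> is \<open>K t (X t)\<close>.
\<close>

locale markov_process = prob_space P
  for P :: "'a measure" and M :: "'b measure"
    and X :: "nat \<Rightarrow> 'a \<Rightarrow> 'b" and K :: "nat \<Rightarrow> 'b \<Rightarrow> 'b measure" +
  assumes random_variable_X: "\<And>t. X t \<in> measurable P M"
    and kernel_K: "\<And>t. K t \<in> measurable M (prob_algebra M)"
    and markov_property: "\<And>t A. A \<in> sets M \<Longrightarrow>
      AE \<omega> in P. real_cond_exp P (natural_filtration P M X t)
                   (indicator (X (Suc t) -` A \<inter> space P)) \<omega> = measure (K t (X t \<omega>)) A"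

text \<open>The infimum of the empty set is \<open>\<infinity>\<close>, i.e. the hitting time is infinite if zero is never hit.\<close>

definition hitting_time_zero :: "('b \<Rightarrow> real) \<Rightarrow> (nat \<Rightarrow> 'a \<Rightarrow> 'b) \<Rightarrow> 'a \<Rightarrow> enat" where
  "hitting_time_zero f X \<omega> = Inf {enat t | t. f (X t \<omega>) = 0}"

text \<open>
  Conditional expectation given an event: \<open>uniform_measure N A\<close> is \<open>N\<close> conditioned on \<open>A\<close>.
  If \<open>A\<close> is a null set, the value is \<open>0\<close>.
\<close>

definition cond_expectation :: "'b measure \<Rightarrow> ('b \<Rightarrow> real) \<Rightarrow> ('b \<Rightarrow> bool) \<Rightarrow> real" where
  "cond_expectation N g Q = (\<integral>y. g y \<partial>uniform_measure N {y \<in> space N. Q y})"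

text \<open>
  The supremum is taken in the extended nonnegative reals, so that it is \<open>\<infinity>\<close> for an unbounded
  set and \<open>0\<close> for the empty set, with reciprocals \<open>0\<close> and \<open>\<infinity>\<close>.
\<close>

definition drift_sup :: "'b measure \<Rightarrow> ('b \<Rightarrow> real) \<Rightarrow> real \<Rightarrow> ('b \<Rightarrow> real) \<Rightarrow> real \<Rightarrow> ennreal" where
  "drift_sup M f U \<mu> z = (SUP x \<in> {x \<in> space M. f x \<in> {z..<z + U}}. ennreal (\<mu> x))"

definition drift_potential ::
  "'b measure \<Rightarrow> ('b \<Rightarrow> real) \<Rightarrow> real \<Rightarrow> ('b \<Rightarrow> real) \<Rightarrow> 'b \<Rightarrow> ennreal" where
  "drift_potential M f U \<mu> x = (\<integral>\<^sup>+ z \<in> {0..f x}. 1 / drift_sup M f U \<mu> z \<partial>lborel)"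

end

theory Submission
  imports Defs
begin

text \<open>
  Put \<open>h(a) = a / (\<epsilon> a + 1 - \<epsilon>)\<close>, a concave function with \<open>h(0) = 0\<close>. A step of size below \<open>U\<close>
  from \<open>x\<close> only crosses levels \<open>z\<close> with \<open>\<mu>\<^sub>x \<le> m\<^sub>z\<close>, so it lowers \<open>T\<close> by at most its size divided by
  \<open>\<mu>\<^sub>x\<close>, hence by at most \<open>1\<close> in conditional expectation. A larger step happens with probability at
  most \<open>\<epsilon>\<close> and costs at most the whole of \<open>h(T)\<close>. Together, \<open>h(T(X\<^sub>t))\<close> decreases by at most \<open>1\<close> in
  expectation per step before \<open>\<tau>\<close>; summing over \<open>t\<close> on the events \<open>t < \<tau>\<close>, which lie in the past
  of \<open>t\<close>, gives \<open>h(T(X\<^sub>0)) \<le> E[\<tau>]\<close>.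

  The summation needs a bounded potential, while \<open>T\<close> may be infinite. The truncations \<open>min(T, c)\<close>
  satisfy the same one-step bounds as \<open>T\<close>, so the argument applies to them, and \<open>c \<rightarrow> \<infinity>\<close> at the end.
\<close>

section \<open>Markov processes\<close>

context markov_process
begin

declare random_variable_X [measurable]

lemma X_in_space: "\<omega> \<in> space P \<Longrightarrow> X t \<omega> \<in> space M"
  by (rule measurable_space[OF random_variable_X])

lemma subalgebra_natural_filtration: "subalgebra P (natural_filtration P M X t)"
proof -
  have "{X s -` A \<inter> space P | s A. s \<le> t \<and> A \<in> sets M} \<subseteq> sets P"
    using random_variable_X by (auto intro: measurable_sets)
  then show ?thesis
    unfolding subalgebra_def natural_filtration_def
    by (intro conjI, simp add: space_measure_of_conv)
       (subst sets_measure_of, auto intro!: sets.sigma_sets_subset)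
qed

lemma space_natural_filtration: "space (natural_filtration P M X t) = space P"
  using subalgebra_natural_filtration by (simp add: subalgebra_def)

lemma sets_natural_filtrationD: "A \<in> sets (natural_filtration P M X t) \<Longrightarrow> A \<in> events"
  using subalgebra_natural_filtration by (auto simp: subalgebra_def)

lemma measurable_natural_filtration:
  assumes "s \<le> t"
  shows "X s \<in> measurable (natural_filtration P M X t) M"
proof (rule measurableI)
  show "X s \<omega> \<in> space M" if "\<omega> \<in> space (natural_filtration P M X t)" for \<omega>
    using that X_in_space by (simp add: space_natural_filtration)
  show "X s -` A \<inter> space (natural_filtration P M X t) \<in> sets (natural_filtration P M X t)"
    if "A \<in> sets M" for A
    unfolding space_natural_filtration using that assms
    by (subst natural_filtration_def, subst sets_measure_of) auto
qed

lemma measurable_kernel_subprob [measurable]: "K t \<in> measurable M (subprob_algebra M)"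
  using kernel_K by (rule measurable_prob_algebraD)

lemma prob_space_kernel: "x \<in> space M \<Longrightarrow> prob_space (K t x)"
  using measurable_space[OF kernel_K] by (simp add: space_prob_algebra)

lemma sets_kernel_eq: "x \<in> space M \<Longrightarrow> sets (K t x) = sets M"
  using measurable_space[OF kernel_K] by (simp add: space_prob_algebra)

lemma emeasure_kernel_eq_measure: "x \<in> space M \<Longrightarrow> emeasure (K t x) B = measure (K t x) B"
  using prob_space_kernel by (intro finite_measure.emeasure_eq_measure prob_space.finite_measure)

lemma emeasure_past_Int_next:
  assumes A: "A \<in> sets (natural_filtration P M X t)" and B: "B \<in> sets M"
  shows "emeasure P (A \<inter> (X (Suc t) -` B \<inter> space P))
         = (\<integral>\<^sup>+\<omega>\<in>A. emeasure (K t (X t \<omega>)) B \<partial>P)"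
proof -
  let ?F = "natural_filtration P M X t" and ?C = "X (Suc t) -` B \<inter> space P"
  interpret F: finite_measure_subalgebra P ?F
    by unfold_locales (rule subalgebra_natural_filtration)
  have [measurable]: "A \<in> sets P"
    using A by (rule sets_natural_filtrationD)
  have C[measurable]: "?C \<in> sets P"
    using random_variable_X B by (rule measurable_sets)
  have [measurable]: "(\<lambda>\<omega>. measure (K t (X t \<omega>)) B) \<in> borel_measurable P"
    using B by measurable
  have kernel_le_1: "measure (K t (X t \<omega>)) B \<le> 1" if "\<omega> \<in> space P" for \<omega>
    using prob_space.prob_le_1[OF prob_space_kernel[OF X_in_space[OF that]]] .
  have integrable_kernel: "integrable P (\<lambda>\<omega>. indicator A \<omega> * measure (K t (X t \<omega>)) B)"
    by (rule integrable_const_bound[of _ 1])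
       (auto intro!: AE_I2 kernel_le_1 split: split_indicator)
  have "measure P (A \<inter> ?C) = (\<integral>\<omega>\<in>A. indicator ?C \<omega> \<partial>P)"
    by (simp add: set_lebesgue_integral_def indicator_inter_arith[symmetric] Int_assoc)
  also have "\<dots> = (\<integral>\<omega>\<in>A. real_cond_exp P ?F (indicator ?C) \<omega> \<partial>P)"
    using A C
    by (intro F.real_cond_exp_intA integrable_real_indicator) (auto simp: emeasure_eq_measure)
  also have "\<dots> = (\<integral>\<omega>\<in>A. measure (K t (X t \<omega>)) B \<partial>P)"
    using markov_property[OF B, of t] by (intro set_lebesgue_integral_cong_AE) auto
  finally have "ennreal (measure P (A \<inter> ?C)) =
      (\<integral>\<^sup>+\<omega>. ennreal (indicator A \<omega> * measure (K t (X t \<omega>)) B) \<partial>P)"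
    by (subst nn_integral_eq_integral[OF integrable_kernel]) (auto simp: set_lebesgue_integral_def)
  also have "\<dots> = (\<integral>\<^sup>+\<omega>\<in>A. emeasure (K t (X t \<omega>)) B \<partial>P)"
    by (intro nn_integral_cong)
       (auto simp: emeasure_kernel_eq_measure X_in_space split: split_indicator)
  finally show ?thesis
    by (simp add: emeasure_eq_measure)
qed

lemma distr_next_eq_bind_kernel:
  assumes A: "A \<in> sets (natural_filtration P M X t)"
  defines "Q \<equiv> density P (indicator A)"
  shows "distr Q M (X (Suc t)) = distr Q M (X t) \<bind> K t"
proof (rule measure_eqI)
  have [measurable]: "A \<in> sets P"
    using A by (rule sets_natural_filtrationD)
  have nonempty: "space (distr Q M (X t)) \<noteq> {}"
    using not_empty X_in_space by auto
  have kernel: "K t \<in> measurable (distr Q M (X t)) (subprob_algebra M)"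
    using measurable_kernel_subprob by simp
  show "sets (distr Q M (X (Suc t))) = sets (distr Q M (X t) \<bind> K t)"
    using nonempty by (subst sets_bind[of _ _ M]) (auto simp: sets_kernel_eq)
  fix B assume "B \<in> sets (distr Q M (X (Suc t)))"
  then have B[measurable]: "B \<in> sets M" by simp
  have "emeasure (distr Q M (X (Suc t))) B = emeasure P (A \<inter> (X (Suc t) -` B \<inter> space P))"
    by (simp add: Q_def emeasure_distr emeasure_density flip: indicator_inter_arith)
  also have "\<dots> = (\<integral>\<^sup>+\<omega>\<in>A. emeasure (K t (X t \<omega>)) B \<partial>P)"
    by (rule emeasure_past_Int_next[OF A B])
  also have "\<dots> = emeasure (distr Q M (X t) \<bind> K t) B"
    by (subst emeasure_bind[OF nonempty kernel B])
       (simp add: Q_def nn_integral_distr nn_integral_density mult.commute)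
  finally show "emeasure (distr Q M (X (Suc t))) B = emeasure (distr Q M (X t) \<bind> K t) B" .
qed

lemma nn_set_integral_next:
  assumes A: "A \<in> sets (natural_filtration P M X t)" and g[measurable]: "g \<in> borel_measurable M"
  shows "(\<integral>\<^sup>+\<omega>\<in>A. g (X (Suc t) \<omega>) \<partial>P) = (\<integral>\<^sup>+\<omega>\<in>A. (\<integral>\<^sup>+y. g y \<partial>K t (X t \<omega>)) \<partial>P)"
proof -
  let ?Q = "density P (indicator A)"
  have [measurable]: "A \<in> sets P"
    using A by (rule sets_natural_filtrationD)
  have kernel: "K t \<in> measurable (distr ?Q M (X t)) (subprob_algebra M)"
    using measurable_kernel_subprob by simp
  have "(\<integral>\<^sup>+\<omega>\<in>A. g (X (Suc t) \<omega>) \<partial>P) = (\<integral>\<^sup>+y. g y \<partial>distr ?Q M (X (Suc t)))"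
    by (simp add: nn_integral_distr nn_integral_density mult.commute)
  also have "\<dots> = (\<integral>\<^sup>+y. g y \<partial>(distr ?Q M (X t) \<bind> K t))"
    by (simp only: distr_next_eq_bind_kernel[OF A])
  also have "\<dots> = (\<integral>\<^sup>+x. (\<integral>\<^sup>+y. g y \<partial>K t x) \<partial>distr ?Q M (X t))"
    by (rule nn_integral_bind[OF g kernel])
  also have "\<dots> = (\<integral>\<^sup>+\<omega>\<in>A. (\<integral>\<^sup>+y. g y \<partial>K t (X t \<omega>)) \<partial>P)"
    by (simp add: nn_integral_distr nn_integral_density mult.commute)
  finally show ?thesis .
qed

end

section \<open>Potentials and hitting times\<close>

lemma less_hitting_time_zero_iff:
  "enat t < hitting_time_zero f X \<omega> \<longleftrightarrow> (\<forall>s\<le>t. f (X s \<omega>) \<noteq> 0)"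
proof -
  have "enat t < hitting_time_zero f X \<omega> \<longleftrightarrow> enat (Suc t) \<le> hitting_time_zero f X \<omega>"
    by (simp add: Suc_ile_eq)
  also have "\<dots> \<longleftrightarrow> (\<forall>s. f (X s \<omega>) = 0 \<longrightarrow> Suc t \<le> s)"
    unfolding hitting_time_zero_def le_Inf_iff enat_ord_simps(1)[symmetric] by blast
  also have "\<dots> \<longleftrightarrow> (\<forall>s\<le>t. f (X s \<omega>) \<noteq> 0)"
    by (auto simp: not_less_eq_eq[symmetric])
  finally show ?thesis .
qed

lemma hitting_time_zero_eq_INF:
  "hitting_time_zero f X \<omega> = (INF t. if f (X t \<omega>) = 0 then enat t else \<infinity>)"
  unfolding hitting_time_zero_def
proof (rule antisym)
  show "Inf {enat t | t. f (X t \<omega>) = 0} \<le> (INF t. if f (X t \<omega>) = 0 then enat t else \<infinity>)"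
    by (rule INF_greatest) (simp add: Inf_lower)
  show "(INF t. if f (X t \<omega>) = 0 then enat t else \<infinity>) \<le> Inf {enat t | t. f (X t \<omega>) = 0}"
  proof (rule Inf_greatest, clarify)
    fix t assume "f (X t \<omega>) = 0"
    then show "(INF t. if f (X t \<omega>) = 0 then enat t else \<infinity>) \<le> enat t"
      by (intro INF_lower2[of t]) simp_all
  qed
qed

context markov_process
begin

lemma measurable_hitting_time_zero:
  assumes [measurable]: "f \<in> borel_measurable M"
  shows "hitting_time_zero f X \<in> measurable P (count_space UNIV)"
  unfolding hitting_time_zero_eq_INF[abs_def] by measurable

lemma less_hitting_time_zero_in_natural_filtration:
  assumes [measurable]: "f \<in> borel_measurable M"
  shows "{\<omega> \<in> space P. enat t < hitting_time_zero f X \<omega>} \<in> sets (natural_filtration P M X t)"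
proof -
  have [measurable]: "X s \<in> measurable (natural_filtration P M X t) M" if "s \<in> {..t}" for s
    using that by (intro measurable_natural_filtration) simp
  have less_iff: "{\<omega> \<in> space P. enat t < hitting_time_zero f X \<omega>}
      = {\<omega> \<in> space (natural_filtration P M X t). \<forall>s\<in>{..t}. f (X s \<omega>) \<noteq> 0}"
    by (auto simp: space_natural_filtration less_hitting_time_zero_iff)
  show ?thesis unfolding less_iff by measurable
qed

lemma potential_telescope:
  fixes f :: "'b \<Rightarrow> real" and H :: "'b \<Rightarrow> ennreal"
  defines "\<tau> \<equiv> hitting_time_zero f X"
  assumes f[measurable]: "f \<in> borel_measurable M" and H[measurable]: "H \<in> borel_measurable M"
    and H_zero: "\<And>x. x \<in> space M \<Longrightarrow> f x = 0 \<Longrightarrow> H x = 0"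
    and drift: "\<And>t. AE \<omega> in P. f (X t \<omega>) \<noteq> 0 \<longrightarrow> H (X t \<omega>) \<le> (\<integral>\<^sup>+y. H y \<partial>K t (X t \<omega>)) + 1"
  shows "(\<integral>\<^sup>+\<omega>. H (X 0 \<omega>) \<partial>P) \<le> (\<integral>\<^sup>+\<omega>\<in>{\<omega> \<in> space P. n < \<tau> \<omega>}. H (X n \<omega>) \<partial>P)
           + (\<Sum>t<n. emeasure P {\<omega> \<in> space P. t < \<tau> \<omega>})"
proof (induction n)
  case 0
  have "H (X 0 \<omega>) = H (X 0 \<omega>) * indicator {\<omega> \<in> space P. 0 < \<tau> \<omega>} \<omega>" if "\<omega> \<in> space P" for \<omega>
    using that H_zero[OF X_in_space[OF that, of 0]] less_hitting_time_zero_iff[of 0 f X \<omega>]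
    by (auto simp: \<tau>_def zero_enat_def split: split_indicator)
  then show ?case
    by (auto simp: zero_enat_def[symmetric] intro!: eq_refl nn_integral_cong)
next
  case (Suc n)
  let ?A = "\<lambda>t::nat. {\<omega> \<in> space P. t < \<tau> \<omega>}"
  have A: "?A n \<in> sets (natural_filtration P M X n)"
    unfolding \<tau>_def using f by (rule less_hitting_time_zero_in_natural_filtration)
  then have [measurable]: "?A n \<in> sets P"
    by (rule sets_natural_filtrationD)
  have "(\<integral>\<^sup>+\<omega>\<in>?A n. H (X n \<omega>) \<partial>P) \<le> (\<integral>\<^sup>+\<omega>\<in>?A n. (\<integral>\<^sup>+y. H y \<partial>K n (X n \<omega>)) + 1 \<partial>P)"
    using drift[of n]
    by (intro nn_integral_mono_AE, eventually_elim)
       (auto simp: \<tau>_def less_hitting_time_zero_iff split: split_indicator)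
  also have "\<dots> = (\<integral>\<^sup>+\<omega>\<in>?A n. (\<integral>\<^sup>+y. H y \<partial>K n (X n \<omega>)) \<partial>P) + emeasure P (?A n)"
    by (simp add: distrib_right nn_integral_add)
  also have "(\<integral>\<^sup>+\<omega>\<in>?A n. (\<integral>\<^sup>+y. H y \<partial>K n (X n \<omega>)) \<partial>P) = (\<integral>\<^sup>+\<omega>\<in>?A n. H (X (Suc n) \<omega>) \<partial>P)"
    using A H by (rule nn_set_integral_next[symmetric])
  also have "\<dots> = (\<integral>\<^sup>+\<omega>\<in>?A (Suc n). H (X (Suc n) \<omega>) \<partial>P)"
    by (intro nn_integral_cong)
       (auto simp: \<tau>_def less_hitting_time_zero_iff H_zero X_in_space le_Suc_eq split: split_indicator)
  finally have step: "(\<integral>\<^sup>+\<omega>\<in>?A n. H (X n \<omega>) \<partial>P)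
      \<le> (\<integral>\<^sup>+\<omega>\<in>?A (Suc n). H (X (Suc n) \<omega>) \<partial>P) + emeasure P (?A n)" .
  note Suc.IH
  also note add_right_mono[OF step]
  finally show ?case by (simp add: add_ac)
qed

lemma expected_potential_le_expected_hitting_time_zero:
  fixes f :: "'b \<Rightarrow> real" and H :: "'b \<Rightarrow> ennreal"
  assumes f[measurable]: "f \<in> borel_measurable M" and H: "H \<in> borel_measurable M"
    and H_zero: "\<And>x. x \<in> space M \<Longrightarrow> f x = 0 \<Longrightarrow> H x = 0"
    and H_le: "\<And>x. x \<in> space M \<Longrightarrow> H x \<le> C" and C: "C < \<infinity>"
    and drift: "\<And>t. AE \<omega> in P. f (X t \<omega>) \<noteq> 0 \<longrightarrow> H (X t \<omega>) \<le> (\<integral>\<^sup>+y. H y \<partial>K t (X t \<omega>)) + 1"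
  shows "(\<integral>\<^sup>+\<omega>. H (X 0 \<omega>) \<partial>P) \<le> (\<integral>\<^sup>+\<omega>. ennreal_of_enat (hitting_time_zero f X \<omega>) \<partial>P)"
    (is "?H0 \<le> ?E")
proof (cases "?E = top")
  case False
  let ?A = "\<lambda>t::nat. {\<omega> \<in> space P. t < hitting_time_zero f X \<omega>}"
  have [measurable]: "?A t \<in> sets P" for t
    by (rule sets_natural_filtrationD[OF less_hitting_time_zero_in_natural_filtration[OF f]])
  have E_eq: "?E = (\<Sum>t. emeasure P (?A t))"
    by (rule nn_integral_enat_function[OF measurable_hitting_time_zero[OF f]])
  have bound: "?H0 \<le> C * emeasure P (?A n) + ?E" for n
  proof -
    have "(\<integral>\<^sup>+\<omega>\<in>?A n. H (X n \<omega>) \<partial>P) \<le> (\<integral>\<^sup>+\<omega>\<in>?A n. C \<partial>P)"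
      by (intro nn_integral_mono) (auto intro: H_le X_in_space split: split_indicator)
    also have "\<dots> = C * emeasure P (?A n)"
      by (rule nn_integral_cmult_indicator) measurable
    finally have "(\<integral>\<^sup>+\<omega>\<in>?A n. H (X n \<omega>) \<partial>P) \<le> C * emeasure P (?A n)" .
    moreover have "(\<Sum>t<n. emeasure P (?A t)) \<le> ?E"
      unfolding E_eq by (intro sum_le_suminf) auto
    ultimately show ?thesis
      using potential_telescope[OF f H H_zero drift, of n] by (meson add_mono order_trans)
  qed
  have "summable (\<lambda>t. measure P (?A t))"
    using False unfolding E_eq emeasure_eq_measure by (intro summable_suminf_not_top) auto
  then have "(\<lambda>n. emeasure P (?A n)) \<longlonglongrightarrow> ennreal 0"
    unfolding emeasure_eq_measure by (intro tendsto_ennrealI summable_LIMSEQ_zero)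
  with C have "(\<lambda>n. C * emeasure P (?A n) + ?E) \<longlonglongrightarrow> C * ennreal 0 + ?E"
    by (intro tendsto_add ennreal_tendsto_cmult tendsto_const) auto
  with bound have "?H0 \<le> C * ennreal 0 + ?E"
    by (intro LIMSEQ_le_const) auto
  then show ?thesis by simp
qed simp

end

section \<open>Saturation\<close>

text \<open>For \<open>\<epsilon> = 1\<close>, \<open>a = 0\<close> the value is \<open>0 / 0 = 0\<close>.\<close>

definition saturation :: "real \<Rightarrow> real \<Rightarrow> real" where
  "saturation \<epsilon> a = a / (\<epsilon> * a + (1 - \<epsilon>))"

lemma measurable_saturation [measurable]: "saturation \<epsilon> \<in> borel_measurable borel"
  unfolding saturation_def by measurable

lemma saturation_zero [simp]: "saturation \<epsilon> 0 = 0"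
  by (simp add: saturation_def)

lemma saturation_one [simp]: "saturation \<epsilon> 1 = 1"
  by (simp add: saturation_def)

lemma saturation_nonneg: "0 \<le> \<epsilon> \<Longrightarrow> \<epsilon> \<le> 1 \<Longrightarrow> 0 \<le> a \<Longrightarrow> 0 \<le> saturation \<epsilon> a"
  by (simp add: saturation_def)

lemma saturation_denominator_pos:
  fixes \<epsilon> a :: real
  assumes "0 \<le> \<epsilon>" "\<epsilon> \<le> 1" "0 < a"
  shows "0 < \<epsilon> * a + (1 - \<epsilon>)"
  using assms by (cases "\<epsilon> = 0") (auto intro: add_pos_nonneg)

lemma saturation_mono:
  assumes \<epsilon>: "0 \<le> \<epsilon>" "\<epsilon> \<le> 1" and "0 \<le> a" "a \<le> b"
  shows "saturation \<epsilon> a \<le> saturation \<epsilon> b"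
proof (cases "a = 0")
  case True
  then show ?thesis using assms saturation_nonneg[of \<epsilon> b] by simp
next
  case False
  then have "0 < \<epsilon> * a + (1 - \<epsilon>)" "0 < \<epsilon> * b + (1 - \<epsilon>)"
    using assms by (auto intro!: saturation_denominator_pos)
  moreover have "(1 - \<epsilon>) * a \<le> (1 - \<epsilon>) * b"
    using assms by (intro mult_left_mono) auto
  then have "a * (\<epsilon> * b + (1 - \<epsilon>)) \<le> b * (\<epsilon> * a + (1 - \<epsilon>))"
    by (simp add: algebra_simps)
  ultimately show ?thesis
    unfolding saturation_def using frac_le_eq by (simp add: pos_divide_le_eq pos_le_divide_eq mult.commute)
qed

lemma saturation_ge_chord:
  assumes "0 \<le> \<epsilon>" "\<epsilon> \<le> 1" "0 \<le> b" "b \<le> a"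
  shows "b / (\<epsilon> * a + (1 - \<epsilon>)) \<le> saturation \<epsilon> b"
proof (cases "b = 0")
  case False
  then show ?thesis
    unfolding saturation_def
    using assms saturation_denominator_pos[of \<epsilon> b] saturation_denominator_pos[of \<epsilon> a]
    by (intro divide_left_mono) (auto intro: mult_left_mono)
qed simp

lemma saturation_le_chord_add_1:
  assumes \<epsilon>: "0 \<le> \<epsilon>" "\<epsilon> \<le> 1" and "1 \<le> a" and p: "1 - \<epsilon> \<le> p" "(a - 1) * p \<le> s"
  shows "saturation \<epsilon> a \<le> s / (\<epsilon> * a + (1 - \<epsilon>)) + 1"
proof -
  let ?D = "\<epsilon> * a + (1 - \<epsilon>)"
  have D: "0 < ?D" using \<epsilon> \<open>1 \<le> a\<close> by (intro saturation_denominator_pos) auto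
  have "a - ?D = (a - 1) * (1 - \<epsilon>)" by (simp add: algebra_simps)
  also have "\<dots> \<le> (a - 1) * p" using p(1) \<open>1 \<le> a\<close> by (intro mult_left_mono) auto
  finally have "(a - ?D) / ?D \<le> s / ?D" using p(2) D by (intro divide_right_mono) auto
  then show ?thesis using D by (simp add: saturation_def diff_divide_distrib)
qed

lemma saturation_le_iff:
  assumes "0 \<le> \<epsilon>" "\<epsilon> \<le> 1" "0 \<le> a" "0 \<le> r"
  shows "saturation \<epsilon> a \<le> r \<longleftrightarrow> a \<le> r * (\<epsilon> * a + (1 - \<epsilon>))"
  using assms saturation_denominator_pos[of \<epsilon> a]
  by (cases "a = 0") (auto simp: saturation_def pos_divide_le_eq)

lemma inverse_le_if_saturation_le:
  assumes \<epsilon>: "0 \<le> \<epsilon>" "\<epsilon> \<le> 1" and le: "\<And>a. 0 \<le> a \<Longrightarrow> ennreal (saturation \<epsilon> a) \<le> B"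
  shows "1 / ennreal \<epsilon> \<le> B"
proof (cases B)
  case (real r)
  have bound: "a * (1 - \<epsilon> * r) \<le> r * (1 - \<epsilon>)" if "0 \<le> a" for a
  proof -
    have "saturation \<epsilon> a \<le> r" using le[OF that] real by simp
    then show ?thesis
      using that \<epsilon> real by (simp add: saturation_le_iff algebra_simps)
  qed
  have "1 \<le> \<epsilon> * r"
  proof (rule ccontr)
    assume "\<not> 1 \<le> \<epsilon> * r"
    then have "0 < 1 - \<epsilon> * r" by simp
    moreover from this have "0 \<le> (r * (1 - \<epsilon>) + 1) / (1 - \<epsilon> * r)"
      using real \<epsilon> by (intro divide_nonneg_pos add_nonneg_nonneg mult_nonneg_nonneg) auto
    ultimately show False
      using bound[of "(r * (1 - \<epsilon>) + 1) / (1 - \<epsilon> * r)"] by simp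
  qed
  then have "0 < \<epsilon>" using \<epsilon> by (cases "\<epsilon> = 0") auto
  have "1 / ennreal \<epsilon> = ennreal (1 / \<epsilon>)"
    using divide_ennreal[of 1 \<epsilon>] \<open>0 < \<epsilon>\<close> by simp
  also have "\<dots> \<le> ennreal r"
    using \<open>1 \<le> \<epsilon> * r\<close> \<open>0 < \<epsilon>\<close> by (intro ennreal_leI) (simp add: field_simps)
  finally show ?thesis using real by simp
qed simp

lemma ennreal_saturation:
  assumes "0 \<le> \<epsilon>" "\<epsilon> \<le> 1" "0 \<le> a"
  shows "ennreal a / (ennreal \<epsilon> * ennreal a + ennreal (1 - \<epsilon>)) = ennreal (saturation \<epsilon> a)"
proof (cases "a = 0")
  case False
  have "ennreal \<epsilon> * ennreal a + ennreal (1 - \<epsilon>) = ennreal (\<epsilon> * a + (1 - \<epsilon>))"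
    using assms by (simp add: ennreal_mult)
  then show ?thesis
    using assms False saturation_denominator_pos[of \<epsilon> a]
    by (simp add: saturation_def divide_ennreal del: ennreal_plus)
qed simp

lemma extended_saturation_le_if_truncations_le:
  fixes T B :: ennreal
  assumes \<epsilon>: "0 \<le> \<epsilon>" "\<epsilon> \<le> 1"
    and le: "\<And>c. 0 \<le> c \<Longrightarrow> ennreal (saturation \<epsilon> (enn2real (min T (ennreal c)))) \<le> B"
  shows "(if T = \<infinity> then 1 / ennreal \<epsilon> else T / (ennreal \<epsilon> * T + ennreal (1 - \<epsilon>))) \<le> B"
proof (cases T)
  case (real a)
  then show ?thesis using \<epsilon> le[of a] by (simp add: ennreal_saturation)
next
  case top
  then show ?thesis using le inverse_le_if_saturation_le[OF \<epsilon>, of B] by simp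
qed

section \<open>The expected change in one step\<close>

context prob_space
begin

lemma cond_expectation_mult_prob:
  assumes [measurable]: "g \<in> borel_measurable M" "Measurable.pred M Q"
  shows "cond_expectation M g Q * \<P>(x in M. Q x) = (LINT x:{x \<in> space M. Q x}|M. g x)"
proof -
  let ?A = "{x \<in> space M. Q x}"
  have A: "?A \<in> events" by measurable
  show ?thesis
  proof (cases "prob ?A = 0")
    case True
    with A have "AE x in M. x \<notin> ?A"
      by (intro AE_not_in) (auto simp: null_sets_def emeasure_eq_measure)
    then have "(LINT x:?A|M. g x) = (LINT x:?A|M. 0)"
      unfolding set_lebesgue_integral_def
      by (intro integral_cong_AE) (auto split: split_indicator)
    with True show ?thesis by simp
  next
    case False
    then have "0 < prob ?A" by (simp add: zero_less_measure_iff)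
    then have "uniform_measure M ?A = density M (\<lambda>x. ennreal (indicator ?A x / prob ?A))"
      unfolding uniform_measure_def
      by (intro density_cong)
         (auto intro!: AE_I2 simp: emeasure_eq_measure divide_ennreal ennreal_1[symmetric]
            simp del: ennreal_1 split: split_indicator)
    then have "cond_expectation M g Q = (\<integral>x. (indicator ?A x / prob ?A) *\<^sub>R g x \<partial>M)"
      unfolding cond_expectation_def using A by (subst integral_density[symmetric]) auto
    also have "\<dots> = (LINT x:?A|M. g x) / prob ?A"
      by (simp add: set_lebesgue_integral_def times_divide_eq_left)
    finally show ?thesis using \<open>0 < prob ?A\<close> by simp
  qed
qed

lemma truncated_drift_le:
  assumes S: "integrable M S" and d[measurable]: "d \<in> borel_measurable M"
    and d_nonneg: "AE y in M. 0 \<le> d y"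
    and small: "AE y in M. d y < U \<longrightarrow> a - S y \<le> d y / m"
    and m: "0 < m" "cond_expectation M d (\<lambda>y. d y < U) \<le> m"
  shows "(a - 1) * \<P>(y in M. d y < U) \<le> (LINT y:{y \<in> space M. d y < U}|M. S y)"
proof -
  let ?A = "{y \<in> space M. d y < U}"
  have A[measurable]: "?A \<in> events" by measurable
  have int_d: "set_integrable M ?A d"
    unfolding set_integrable_def
  proof (rule integrable_const_bound)
    show "AE y in M. norm (indicator ?A y *\<^sub>R d y) \<le> \<bar>U\<bar>"
      using d_nonneg by eventually_elim (auto split: split_indicator)
    show "(\<lambda>y. indicator ?A y *\<^sub>R d y) \<in> borel_measurable M" by measurable
  qed
  then have int_dm: "set_integrable M ?A (\<lambda>y. d y / m)"
    by (rule set_integrable_divide)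
  have int_const: "set_integrable M ?A (\<lambda>_. a)"
    using A by (simp add: set_integrable_def emeasure_eq_measure)
  have int_S: "set_integrable M ?A S"
    unfolding set_integrable_def using A S by (rule integrable_mult_indicator)
  have "(LINT y:?A|M. d y) \<le> m * prob ?A"
    using m(2) by (subst cond_expectation_mult_prob[symmetric]) (auto intro: mult_right_mono)
  then have "(LINT y:?A|M. d y / m) \<le> prob ?A"
    using m(1) by (simp add: pos_divide_le_eq mult.commute)
  then have "(a - 1) * prob ?A \<le> (LINT y:?A|M. a) - (LINT y:?A|M. d y / m)"
    by (simp add: set_lebesgue_integral_def algebra_simps)
  also have "\<dots> = (LINT y:?A|M. a - d y / m)"
    by (rule set_integral_diff(2)[OF int_const int_dm, symmetric])
  also have "\<dots> \<le> (LINT y:?A|M. S y)"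
    using small
    by (intro set_integral_mono_AE set_integral_diff int_const int_dm int_S) auto
  finally show ?thesis .
qed

lemma nn_integral_saturation_ge_chord:
  assumes S: "integrable M S" and S_bounds: "AE y in M. 0 \<le> S y \<and> S y \<le> a"
    and \<epsilon>: "0 \<le> \<epsilon>" "\<epsilon> \<le> 1" and "0 \<le> a" and A: "A \<in> events"
  shows "ennreal ((LINT y:A|M. S y) / (\<epsilon> * a + (1 - \<epsilon>)))
         \<le> (\<integral>\<^sup>+y. ennreal (saturation \<epsilon> (S y)) \<partial>M)"
proof -
  let ?D = "\<epsilon> * a + (1 - \<epsilon>)"
  have D: "0 \<le> ?D" using \<epsilon> \<open>0 \<le> a\<close> by simp
  have "ennreal ((LINT y:A|M. S y) / ?D) = ennreal (\<integral>y. indicator A y * S y / ?D \<partial>M)"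
    by (simp add: set_lebesgue_integral_def)
  also have "\<dots> = (\<integral>\<^sup>+y. ennreal (indicator A y * S y / ?D) \<partial>M)"
  proof (rule nn_integral_eq_integral[symmetric])
    show "integrable M (\<lambda>y. indicator A y * S y / ?D)"
      using integrable_mult_indicator[OF A S] by simp
    show "AE y in M. 0 \<le> indicator A y * S y / ?D"
      using S_bounds by eventually_elim (use D in auto)
  qed
  also have "\<dots> \<le> (\<integral>\<^sup>+y. ennreal (saturation \<epsilon> (S y)) \<partial>M)"
  proof (rule nn_integral_mono_AE, use S_bounds in eventually_elim, rule ennreal_leI)
    fix y assume "0 \<le> S y \<and> S y \<le> a"
    then show "indicator A y * S y / ?D \<le> saturation \<epsilon> (S y)"
      using \<epsilon> saturation_ge_chord[of \<epsilon> "S y" a] saturation_nonneg[of \<epsilon> "S y"]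
      by (auto split: split_indicator)
  qed
  finally show ?thesis .
qed

text \<open>
  Jumps of size at least \<open>U\<close> are charged the whole potential. Concavity of
  \<^const>\<open>saturation\<close> bounds it below on \<open>[0, a]\<close> by the chord through the origin, and for this
  linear function the expected decrease is at most \<open>1\<close>.
\<close>

lemma saturation_drift_le:
  assumes S[measurable]: "S \<in> borel_measurable M" and d[measurable]: "d \<in> borel_measurable M"
    and S_bounds: "AE y in M. 0 \<le> S y \<and> S y \<le> a"
    and d_nonneg: "AE y in M. 0 \<le> d y"
    and small: "AE y in M. d y < U \<longrightarrow> a - S y \<le> d y / m"
    and large: "\<P>(y in M. U \<le> d y) \<le> \<epsilon>" and "0 \<le> a" "\<epsilon> \<le> 1"
    and m: "0 < m" "cond_expectation M d (\<lambda>y. d y < U) \<le> m"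
  shows "ennreal (saturation \<epsilon> a) \<le> (\<integral>\<^sup>+y. ennreal (saturation \<epsilon> (S y)) \<partial>M) + 1"
proof -
  have \<epsilon>: "0 \<le> \<epsilon>" using large measure_nonneg order_trans by blast
  show ?thesis
  proof (cases "a \<le> 1")
    case True
    then have "saturation \<epsilon> a \<le> 1"
      using saturation_mono[OF \<epsilon> \<open>\<epsilon> \<le> 1\<close> \<open>0 \<le> a\<close>, of 1] by simp
    then show ?thesis by (simp add: add_increasing)
  next
    case False
    let ?A = "{y \<in> space M. d y < U}"
    have A: "?A \<in> events" by measurable
    have int_S: "integrable M S"
      using S_bounds by (intro integrable_const_bound[of _ a]) auto
    have "prob ?A = 1 - \<P>(y in M. U \<le> d y)"
      by (subst prob_neg[symmetric]) (auto simp: not_le)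
    with large have "1 - \<epsilon> \<le> prob ?A" by simp
    then have "saturation \<epsilon> a \<le> (LINT y:?A|M. S y) / (\<epsilon> * a + (1 - \<epsilon>)) + 1"
      using False \<epsilon> \<open>\<epsilon> \<le> 1\<close> truncated_drift_le[OF int_S d d_nonneg small m]
      by (intro saturation_le_chord_add_1) auto
    then have "ennreal (saturation \<epsilon> a) \<le> ennreal ((LINT y:?A|M. S y) / (\<epsilon> * a + (1 - \<epsilon>)) + 1)"
      by (rule ennreal_leI)
    also have "\<dots> \<le> ennreal ((LINT y:?A|M. S y) / (\<epsilon> * a + (1 - \<epsilon>))) + 1"
      by (cases "0 \<le> (LINT y:?A|M. S y) / (\<epsilon> * a + (1 - \<epsilon>))") (auto simp: ennreal_neg)
    also have "\<dots> \<le> (\<integral>\<^sup>+y. ennreal (saturation \<epsilon> (S y)) \<partial>M) + 1"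
      using nn_integral_saturation_ge_chord[OF int_S S_bounds \<epsilon> \<open>\<epsilon> \<le> 1\<close> \<open>0 \<le> a\<close> A]
      by (rule add_right_mono)
    finally show ?thesis .
  qed
qed

end

section \<open>The drift potential\<close>

text \<open>Measurability of \<open>g\<close> is not assumed, as \<open>z \<mapsto> 1 / drift_sup M f U \<mu> z\<close> is a supremum over
  uncountably many states.\<close>

lemma nn_integral_le_add_Compl:
  assumes [measurable]: "A \<in> sets M"
  shows "(\<integral>\<^sup>+x. g x \<partial>M) \<le> (\<integral>\<^sup>+x\<in>A. g x \<partial>M) + (\<integral>\<^sup>+x\<in>-A. g x \<partial>M)"
  unfolding nn_integral_def[of M g]
proof (rule SUP_least, clarify)
  fix s assume s: "simple_function M s" "s \<le> g"
  then have [measurable]: "s \<in> borel_measurable M"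
    by (simp add: borel_measurable_simple_function)
  have "integral\<^sup>S M s = (\<integral>\<^sup>+x. s x \<partial>M)"
    using s by (simp add: nn_integral_eq_simple_integral)
  also have "\<dots> = (\<integral>\<^sup>+x. s x * indicator A x + s x * indicator (space M - A) x \<partial>M)"
    by (intro nn_integral_cong) (auto split: split_indicator)
  also have "\<dots> = (\<integral>\<^sup>+x\<in>A. s x \<partial>M) + (\<integral>\<^sup>+x\<in>space M - A. s x \<partial>M)"
    by (rule nn_integral_add) measurable
  also have "\<dots> \<le> (\<integral>\<^sup>+x\<in>A. g x \<partial>M) + (\<integral>\<^sup>+x\<in>-A. g x \<partial>M)"
    using s by (intro add_mono nn_integral_mono) (auto simp: le_fun_def split: split_indicator)
  finally show "integral\<^sup>S M s \<le> (\<integral>\<^sup>+x\<in>A. g x \<partial>M) + (\<integral>\<^sup>+x\<in>-A. g x \<partial>M)" .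
qed

lemma inverse_antimono_ennreal:
  fixes a b :: ennreal
  shows "a \<le> b \<Longrightarrow> inverse b \<le> inverse a"
  including ennreal.lifting by transfer (auto intro: ereal_inverse_antimono)

lemma inverse_drift_sup_le:
  assumes "x \<in> space M" "0 < \<mu> x" "f x \<in> {z..<z + U}"
  shows "1 / drift_sup M f U \<mu> z \<le> ennreal (1 / \<mu> x)"
proof -
  have "ennreal (\<mu> x) \<le> drift_sup M f U \<mu> z"
    unfolding drift_sup_def using assms by (intro SUP_upper) auto
  then have "1 / drift_sup M f U \<mu> z \<le> 1 / ennreal (\<mu> x)"
    by (simp add: divide_ennreal_def inverse_antimono_ennreal)
  also have "\<dots> = ennreal (1 / \<mu> x)"
    using assms divide_ennreal[of 1 "\<mu> x"] by simp
  finally show ?thesis .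
qed

lemma drift_potential_mono:
  "f x \<le> f y \<Longrightarrow> drift_potential M f U \<mu> x \<le> drift_potential M f U \<mu> y"
  unfolding drift_potential_def by (intro nn_integral_mono) (auto split: split_indicator)

lemma drift_potential_eq_0:
  assumes "f x = 0"
  shows "drift_potential M f U \<mu> x = 0"
proof -
  have "drift_potential M f U \<mu> x = (\<integral>\<^sup>+(z::real). 0 \<partial>lborel)"
    unfolding drift_potential_def
    by (rule nn_integral_cong_AE, rule eventually_mono[OF AE_lborel_singleton[of 0]])
       (simp add: assms)
  then show ?thesis by simp
qed

lemma drift_potential_le_add:
  assumes x: "x \<in> space M" "0 < \<mu> x" and y: "f y \<le> f x" "f x - f y < U"
  shows "drift_potential M f U \<mu> x \<le> drift_potential M f U \<mu> y + ennreal ((f x - f y) / \<mu> x)"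
proof -
  define g where "g z = 1 / drift_sup M f U \<mu> z * indicator {0..f x} z" for z
  have "drift_potential M f U \<mu> x \<le> (\<integral>\<^sup>+z\<in>{..f y}. g z \<partial>lborel) + (\<integral>\<^sup>+z\<in>- {..f y}. g z \<partial>lborel)"
    unfolding drift_potential_def g_def[symmetric] by (rule nn_integral_le_add_Compl) simp
  also have "(\<integral>\<^sup>+z\<in>{..f y}. g z \<partial>lborel) = drift_potential M f U \<mu> y"
    unfolding drift_potential_def g_def using y
    by (intro nn_integral_cong) (auto split: split_indicator)
  also have "(\<integral>\<^sup>+z\<in>- {..f y}. g z \<partial>lborel) \<le> (\<integral>\<^sup>+z\<in>{f y<..f x}. ennreal (1 / \<mu> x) \<partial>lborel)"
    unfolding g_def using x y
    by (intro nn_integral_mono) (auto intro!: inverse_drift_sup_le split: split_indicator)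
  also have "\<dots> = ennreal ((f x - f y) / \<mu> x)"
    using x y by (simp add: nn_integral_cmult_indicator ennreal_mult[symmetric])
  finally show ?thesis by (simp add: add_left_mono)
qed

definition truncated_potential ::
  "'b measure \<Rightarrow> ('b \<Rightarrow> real) \<Rightarrow> real \<Rightarrow> ('b \<Rightarrow> real) \<Rightarrow> real \<Rightarrow> 'b \<Rightarrow> real" where
  "truncated_potential M f U \<mu> c x = enn2real (min (drift_potential M f U \<mu> x) (ennreal c))"

lemma ennreal_truncated_potential:
  "ennreal (truncated_potential M f U \<mu> c x) = min (drift_potential M f U \<mu> x) (ennreal c)"
  unfolding truncated_potential_def by (rule ennreal_enn2real) (simp add: min_less_iff_disj)

lemma truncated_potential_nonneg: "0 \<le> truncated_potential M f U \<mu> c x"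
  by (simp add: truncated_potential_def)

lemma truncated_potential_le: "0 \<le> c \<Longrightarrow> truncated_potential M f U \<mu> c x \<le> c"
  unfolding truncated_potential_def by (rule enn2real_leI) auto

lemma truncated_potential_mono:
  assumes "f x \<le> f y"
  shows "truncated_potential M f U \<mu> c x \<le> truncated_potential M f U \<mu> c y"
  unfolding truncated_potential_def using drift_potential_mono[of f x y M U \<mu>] assms
  by (intro enn2real_mono min.mono) (auto simp: min_less_iff_disj)

lemma truncated_potential_eq_0: "f x = 0 \<Longrightarrow> truncated_potential M f U \<mu> c x = 0"
  by (simp add: truncated_potential_def drift_potential_eq_0)

lemma truncated_potential_diff_le:
  assumes "x \<in> space M" "0 < \<mu> x" "f y \<le> f x" "f x - f y < U"
  shows "truncated_potential M f U \<mu> c x - truncated_potential M f U \<mu> c y \<le> (f x - f y) / \<mu> x"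
proof -
  have "min (drift_potential M f U \<mu> x) (ennreal c)
      \<le> min (drift_potential M f U \<mu> y + ennreal ((f x - f y) / \<mu> x)) (ennreal c)"
    using assms by (intro min.mono drift_potential_le_add order_refl)
  also have "\<dots> \<le> min (drift_potential M f U \<mu> y) (ennreal c) + ennreal ((f x - f y) / \<mu> x)"
    by (auto simp: min_def intro: add_increasing2 order_trans[OF add_increasing2[OF zero_le order_refl]])
  finally have "ennreal (truncated_potential M f U \<mu> c x)
      \<le> ennreal (truncated_potential M f U \<mu> c y + (f x - f y) / \<mu> x)"
    using assms
    by (subst ennreal_plus) (auto simp: ennreal_truncated_potential truncated_potential_nonneg)
  then show ?thesis
    using assms by (subst (asm) ennreal_le_iff) (auto simp: truncated_potential_nonneg)
qed

lemma measurable_truncated_potential: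
  assumes "f \<in> borel_measurable M"
  shows "truncated_potential M f U \<mu> c \<in> borel_measurable M"
proof -
  define G where
    "G w = enn2real (min (\<integral>\<^sup>+z\<in>{0..w}. 1 / drift_sup M f U \<mu> z \<partial>lborel) (ennreal c))" for w
  have "mono G"
    unfolding G_def
    by (intro monoI enn2real_mono min.mono nn_integral_mono)
       (auto simp: min_less_iff_disj split: split_indicator)
  then have "(\<lambda>x. G (f x)) \<in> borel_measurable M"
    by (intro measurable_compose[OF assms] borel_measurable_mono)
  then show ?thesis
    by (simp add: truncated_potential_def[abs_def] drift_potential_def G_def)
qed

section \<open>The lower bound on the expected hitting time\<close>

locale rare_jump_process = markov_process P M X K
  for P :: "'a measure" and M :: "'b measure"
    and X :: "nat \<Rightarrow> 'a \<Rightarrow> 'b" and K :: "nat \<Rightarrow> 'b \<Rightarrow> 'b measure" +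
  fixes f \<mu> :: "'b \<Rightarrow> real" and U \<epsilon> :: real
  assumes measurable_f: "f \<in> borel_measurable M"
    and f_nonneg: "\<And>x. x \<in> space M \<Longrightarrow> f x \<ge> 0"
    and f_decreasing: "\<And>t. AE \<omega> in P. \<P>(y in K t (X t \<omega>). f (X t \<omega>) - f y \<ge> 0) = 1"
    and \<epsilon>_le_1: "\<epsilon> \<le> 1"
    and large_jump_prob_le:
      "\<And>t x. x \<in> space M \<Longrightarrow> f x > 0 \<Longrightarrow> \<P>(y in K t x. f x - f y \<ge> U) \<le> \<epsilon>"
    and \<mu>_pos: "\<And>x. x \<in> space M \<Longrightarrow> f x > 0 \<Longrightarrow> \<mu> x > 0"
    and small_jump_drift_le: "\<And>t x. x \<in> space M \<Longrightarrow> f x > 0 \<Longrightarrow>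
      \<mu> x \<ge> cond_expectation (K t x) (\<lambda>y. f x - f y) (\<lambda>y. f x - f y < U)"
begin

lemma \<epsilon>_nonneg: "x \<in> space M \<Longrightarrow> 0 < f x \<Longrightarrow> 0 \<le> \<epsilon>"
  using large_jump_prob_le measure_nonneg order_trans by blast

lemma saturation_truncated_potential_drift:
  fixes c :: real
  assumes x: "x \<in> space M" "0 < f x" and decreasing: "\<P>(y in K t x. f x - f y \<ge> 0) = 1"
  defines "S \<equiv> truncated_potential M f U \<mu> c"
  shows "ennreal (saturation \<epsilon> (S x)) \<le> (\<integral>\<^sup>+y. ennreal (saturation \<epsilon> (S y)) \<partial>K t x) + 1"
proof -
  interpret kernel: prob_space "K t x" by (rule prob_space_kernel[OF x(1)])
  have [measurable]: "(\<lambda>y. y) \<in> measurable (K t x) M"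
    by (rule measurable_ident_sets[OF sets_kernel_eq[OF x(1)]])
  note [measurable] = measurable_f measurable_truncated_potential[OF measurable_f]
  have "{y \<in> space (K t x). f x - f y \<ge> 0} \<in> kernel.events"
    by measurable
  with decreasing have f_le: "AE y in K t x. f y \<le> f x"
    by (simp add: kernel.prob_Collect_eq_1)
  show ?thesis
  proof (rule kernel.saturation_drift_le[where d = "\<lambda>y. f x - f y" and U = U and m = "\<mu> x"])
    show "AE y in K t x. 0 \<le> S y \<and> S y \<le> S x"
      using f_le by eventually_elim
        (simp add: S_def truncated_potential_nonneg truncated_potential_mono)
    show "AE y in K t x. f x - f y < U \<longrightarrow> S x - S y \<le> (f x - f y) / \<mu> x"
      using f_le by eventually_elim (simp add: S_def truncated_potential_diff_le x \<mu>_pos)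
  qed (use f_le x in \<open>auto simp: S_def truncated_potential_nonneg \<epsilon>_le_1 large_jump_prob_le \<mu>_pos
         small_jump_drift_le\<close>)
qed

lemma expected_saturation_truncated_potential_le:
  assumes "0 \<le> c"
  shows "(\<integral>\<^sup>+\<omega>. ennreal (saturation \<epsilon> (truncated_potential M f U \<mu> c (X 0 \<omega>))) \<partial>P)
         \<le> (\<integral>\<^sup>+\<omega>. ennreal_of_enat (hitting_time_zero f X \<omega>) \<partial>P)"
proof -
  note [measurable] = measurable_truncated_potential[OF measurable_f]
  let ?H = "\<lambda>x. ennreal (saturation \<epsilon> (truncated_potential M f U \<mu> c x))"
  show ?thesis
  proof (rule expected_potential_le_expected_hitting_time_zero
      [where C = "ennreal (saturation \<epsilon> c)", OF measurable_f])
    show "?H x = 0" if "f x = 0" for x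
      using that by (simp add: truncated_potential_eq_0)
    show "?H x \<le> ennreal (saturation \<epsilon> c)" if "x \<in> space M" for x
    proof (cases "f x = 0")
      case True
      then show ?thesis by (simp add: truncated_potential_eq_0)
    next
      case False
      with f_nonneg[OF that] have "0 \<le> \<epsilon>" by (intro \<epsilon>_nonneg[OF that]) simp
      then show ?thesis
        using \<open>0 \<le> c\<close> \<epsilon>_le_1
        by (intro ennreal_leI saturation_mono truncated_potential_nonneg truncated_potential_le)
    qed
    show "AE \<omega> in P. f (X t \<omega>) \<noteq> 0 \<longrightarrow> ?H (X t \<omega>) \<le> (\<integral>\<^sup>+y. ?H y \<partial>K t (X t \<omega>)) + 1" for t
      using f_decreasing[of t] AE_space
    proof eventually_elim
      case (elim \<omega>)
      then show ?case
        using f_nonneg[OF X_in_space, of \<omega> t] X_in_space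
        by (intro impI saturation_truncated_potential_drift) auto
    qed
  qed auto
qed

lemma saturation_truncated_potential_le_expected_hitting_time_zero:
  assumes X0: "\<And>\<omega>. \<omega> \<in> space P \<Longrightarrow> X 0 \<omega> = x0" and "0 \<le> c"
  shows "ennreal (saturation \<epsilon> (truncated_potential M f U \<mu> c x0))
         \<le> (\<integral>\<^sup>+\<omega>. ennreal_of_enat (hitting_time_zero f X \<omega>) \<partial>P)"
  using expected_saturation_truncated_potential_le[OF \<open>0 \<le> c\<close>]
  by (simp add: X0 emeasure_space_1 cong: nn_integral_cong)

end

theorem theorem1:
  fixes P :: "'a measure" and M :: "'b measure"
    and X :: "nat \<Rightarrow> 'a \<Rightarrow> 'b" and K :: "nat \<Rightarrow> 'b \<Rightarrow> 'b measure"
    and x0 :: 'b and f :: "'b \<Rightarrow> real" and \<mu> :: "'b \<Rightarrow> real" and U \<epsilon> :: real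
  defines "T \<equiv> drift_potential M f U \<mu> x0"
  assumes "markov_process P M X K"
    and "\<And>\<omega>. \<omega> \<in> space P \<Longrightarrow> X 0 \<omega> = x0"
    and "f \<in> borel_measurable M"
    and "\<And>x. x \<in> space M \<Longrightarrow> f x \<ge> 0"
    and "\<And>t. AE \<omega> in P. \<P>(y in K t (X t \<omega>). f (X t \<omega>) - f y \<ge> 0) = 1"
    and "\<epsilon> \<le> 1"
    and "\<And>t x. x \<in> space M \<Longrightarrow> f x > 0 \<Longrightarrow> \<P>(y in K t x. f x - f y \<ge> U) \<le> \<epsilon>"
    and "\<And>x. x \<in> space M \<Longrightarrow> f x > 0 \<Longrightarrow> \<mu> x > 0"
    and "\<And>t x. x \<in> space M \<Longrightarrow> f x > 0 \<Longrightarrow>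
           \<mu> x \<ge> cond_expectation (K t x) (\<lambda>y. f x - f y) (\<lambda>y. f x - f y < U)"
  shows "(\<integral>\<^sup>+ \<omega>. ennreal_of_enat (hitting_time_zero f X \<omega>) \<partial>P) \<ge>
           (if T = \<infinity> then 1 / ennreal \<epsilon> else T / (ennreal \<epsilon> * T + ennreal (1 - \<epsilon>)))"
proof -
  interpret rare_jump_process P M X K f \<mu> U \<epsilon>
    using assms by (intro rare_jump_process.intro rare_jump_process_axioms.intro)
  obtain \<omega> where "\<omega> \<in> space P" using not_empty by auto
  then have x0: "x0 \<in> space M" using X_in_space[of \<omega> 0] assms(3) by simp
  show ?thesis
  proof (cases "f x0 = 0")
    case True
    then show ?thesis by (simp add: T_def drift_potential_eq_0)
  next
    case False
    then have "0 \<le> \<epsilon>" using f_nonneg[OF x0] by (intro \<epsilon>_nonneg[OF x0]) simp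
    then show ?thesis
    proof (rule extended_saturation_le_if_truncations_le[OF _ \<epsilon>_le_1])
      fix c :: real assume "0 \<le> c"
      with assms(3) show "ennreal (saturation \<epsilon> (enn2real (min T (ennreal c))))
          \<le> (\<integral>\<^sup>+\<omega>. ennreal_of_enat (hitting_time_zero f X \<omega>) \<partial>P)"
        unfolding T_def truncated_potential_def[symmetric]
        by (rule saturation_truncated_potential_le_expected_hitting_time_zero)
    qed
  qed
qed

end
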